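(* Let $(G,\circ)$ be a group, and let the invertible map $\check r:G\times G\to G\times G$, $\check r(x,y)=(\sigma^p_x(y),\tau^p_y(x))$, be a $p$-braiding operator for the group $G$. Then $\check r$ is a non-degenerate solution of the braid equation.
   Context: Let $(G,\circ)$ be a group, $m(x,y)=x\circ y$, and let $\check r:G\times G\to G\times G$ be an invertible map, $\check r(x,y)=(\sigma^p_x(y),\tau^p_y(x))$ for all $x,y\in G$, where all $\sigma^p_x,\tau^p_y$ are bijective maps of $G$. Write $\check r_{12}=\check r\times\mathrm{id}$ and $\check r_{23}=\mathrm{id}\times\check r$ on $G\times G\times G$; products of maps denote composition (rightmost applied first). The map $\check r$ is called a $p$-braiding operator (and $G$ is called $p$-braided) if there exist bijections $f^p_x,g^p_x:G\to G$, given for all $x\in G$, such that for all $x,y,w\in G$: (1) $x\circ y=\sigma^p_x(y)\circ\tau^p_y(x)$; (2) $(\mathrm{id}\times m)\,\check r_{12}\,\check r_{23}(x,y,w)=(f^p_{x\circ y}(w),\ f^p_{x\circ y}(w)^{-1}\circ x\circ y\circ w)$; (3) $(m\times\mathrm{id})\,\check r_{23}\,\check r_{12}(x,y,w)=(g^p_x(y\circ w),\ g^p_x(y\circ w)^{-1}\circ x\circ y\circ w)$. Here $^{-1}$ of an element is its inverse in $(G,\circ)$. The map $\check r$ is a solution of the braid equation if $\check r_{12}\check r_{23}\check r_{12}=\check r_{23}\check r_{12}\check r_{23}$, and is non-degenerate if all $\sigma^p_x$ and $\tau^p_y$ are bijections. *)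

theory Defs
  imports "HOL-Algebra.Group"
begin

text \<open>
  Maps on a set \<open>X\<close> are represented by total functions on the type; only their
  values on \<open>X\<close> (respectively \<open>X \<times> X\<close>, \<open>X \<times> X \<times> X\<close>) are constrained.
  A map \<open>r\<close> of \<open>X \<times> X\<close> is written
  \<open>r (x, y) = (sigma_map r x y, tau_map r y x)\<close>; note that the index of \<open>tau\<close> is the
  second entry of the pair.
\<close>

definition sigma_map :: "('a \<times> 'a \<Rightarrow> 'a \<times> 'a) \<Rightarrow> 'a \<Rightarrow> 'a \<Rightarrow> 'a" where
  "sigma_map r x y = fst (r (x, y))"

definition tau_map :: "('a \<times> 'a \<Rightarrow> 'a \<times> 'a) \<Rightarrow> 'a \<Rightarrow> 'a \<Rightarrow> 'a" where
  "tau_map r y x = snd (r (x, y))"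

definition nondegenerate :: "'a set \<Rightarrow> ('a \<times> 'a \<Rightarrow> 'a \<times> 'a) \<Rightarrow> bool" where
  "nondegenerate X r \<longleftrightarrow>
     (\<forall>x\<in>X. bij_betw (sigma_map r x) X X) \<and> (\<forall>y\<in>X. bij_betw (tau_map r y) X X)"

definition act12 :: "('a \<times> 'a \<Rightarrow> 'a \<times> 'a) \<Rightarrow> 'a \<times> 'a \<times> 'a \<Rightarrow> 'a \<times> 'a \<times> 'a" where
  "act12 r = (\<lambda>(x, y, w). (fst (r (x, y)), snd (r (x, y)), w))"

definition act23 :: "('a \<times> 'a \<Rightarrow> 'a \<times> 'a) \<Rightarrow> 'a \<times> 'a \<times> 'a \<Rightarrow> 'a \<times> 'a \<times> 'a" where
  "act23 r = (\<lambda>(x, y, w). (x, r (y, w)))"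

definition braid_solution :: "'a set \<Rightarrow> ('a \<times> 'a \<Rightarrow> 'a \<times> 'a) \<Rightarrow> bool" where
  "braid_solution X r \<longleftrightarrow>
     (\<forall>t \<in> X \<times> X \<times> X.
        (act12 r \<circ> act23 r \<circ> act12 r) t = (act23 r \<circ> act12 r \<circ> act23 r) t)"

definition id_times_mult :: "('a, 'b) monoid_scheme \<Rightarrow> 'a \<times> 'a \<times> 'a \<Rightarrow> 'a \<times> 'a" where
  "id_times_mult G = (\<lambda>(x, y, w). (x, y \<otimes>\<^bsub>G\<^esub> w))"

definition mult_times_id :: "('a, 'b) monoid_scheme \<Rightarrow> 'a \<times> 'a \<times> 'a \<Rightarrow> 'a \<times> 'a" where
  "mult_times_id G = (\<lambda>(x, y, w). (x \<otimes>\<^bsub>G\<^esub> y, w))"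

text \<open>
  Invertibility of \<open>r\<close> and bijectivity of all \<open>sigma_map r x\<close> and \<open>tau_map r y\<close> are part
  of the notion of a p-braiding operator. The families \<open>f\<close> and \<open>g\<close> are required to be
  bijective but are otherwise unrelated to \<open>r\<close> a priori.
\<close>

definition p_braiding_operator ::
    "('a, 'b) monoid_scheme \<Rightarrow> ('a \<times> 'a \<Rightarrow> 'a \<times> 'a) \<Rightarrow> bool" where
  "p_braiding_operator G r \<longleftrightarrow>
     bij_betw r (carrier G \<times> carrier G) (carrier G \<times> carrier G) \<and>
     nondegenerate (carrier G) r \<and>
     (\<exists>f g :: 'a \<Rightarrow> 'a \<Rightarrow> 'a.
        (\<forall>x\<in>carrier G. bij_betw (f x) (carrier G) (carrier G)) \<and>
        (\<forall>x\<in>carrier G. bij_betw (g x) (carrier G) (carrier G)) \<and>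
        (\<forall>x\<in>carrier G. \<forall>y\<in>carrier G. \<forall>w\<in>carrier G.
           x \<otimes>\<^bsub>G\<^esub> y = sigma_map r x y \<otimes>\<^bsub>G\<^esub> tau_map r y x \<and>
           (id_times_mult G \<circ> act12 r \<circ> act23 r) (x, y, w) =
             (f (x \<otimes>\<^bsub>G\<^esub> y) w,
              inv\<^bsub>G\<^esub> (f (x \<otimes>\<^bsub>G\<^esub> y) w) \<otimes>\<^bsub>G\<^esub> x \<otimes>\<^bsub>G\<^esub> y \<otimes>\<^bsub>G\<^esub> w) \<and>
           (mult_times_id G \<circ> act23 r \<circ> act12 r) (x, y, w) =
             (g x (y \<otimes>\<^bsub>G\<^esub> w),
              inv\<^bsub>G\<^esub> (g x (y \<otimes>\<^bsub>G\<^esub> w)) \<otimes>\<^bsub>G\<^esub> x \<otimes>\<^bsub>G\<^esub> y \<otimes>\<^bsub>G\<^esub> w)))"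

end

theory Submission
  imports Defs
begin

text \<open>
  Condition (2) says that \<open>\<sigma>\<^sub>x \<sigma>\<^sub>y\<close> depends only on the product \<open>x \<circ> y\<close>, and condition (3) that
  \<open>\<tau>\<^sub>w \<tau>\<^sub>y\<close> depends only on \<open>y \<circ> w\<close>. Since \<open>r\<close> preserves products by (1), the two sides of the
  braid equation have the same first and third entries; both preserve the product of all three
  entries, so the middle entries agree by cancellation.
\<close>

theorem proposition2p25:
  fixes G :: "('a, 'b) monoid_scheme" and r :: "'a \<times> 'a \<Rightarrow> 'a \<times> 'a"
  assumes "group G"
    and "p_braiding_operator G r"
  shows "braid_solution (carrier G) r \<and> nondegenerate (carrier G) r"
proof
  interpret group G by fact
  let ?s = "sigma_map r" and ?t = "tau_map r"
  show nd: "nondegenerate (carrier G) r"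
    using assms(2) by (simp add: p_braiding_operator_def)
  then have s_closed: "?s x y \<in> carrier G" and t_closed: "?t y x \<in> carrier G"
    if "x \<in> carrier G" "y \<in> carrier G" for x y
    using that by (auto simp: nondegenerate_def dest: bij_betwE)
  note closed = s_closed t_closed
  have r_eq: "r (x, y) = (?s x y, ?t y x)" for x y
    by (simp add: sigma_map_def tau_map_def)
  \<comment> \<open>(1) is oriented so that rewriting contracts a product of outputs of
    \<open>r\<close> to the product of its inputs. \<open>f\<close> is the first component of (2),
    \<open>g\<close> the second component of (3); bijectivity of each \<open>g x\<close> supplies
    \<open>g_closed\<close>.\<close>
  obtain f g where
    mult: "\<And>x y. x \<in> carrier G \<Longrightarrow> y \<in> carrier G \<Longrightarrow> ?s x y \<otimes>\<^bsub>G\<^esub> ?t y x = x \<otimes>\<^bsub>G\<^esub> y"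
    and f: "\<And>x y w. x \<in> carrier G \<Longrightarrow> y \<in> carrier G \<Longrightarrow> w \<in> carrier G \<Longrightarrow>
      ?s x (?s y w) = f (x \<otimes>\<^bsub>G\<^esub> y) w"
    and g: "\<And>x y w. x \<in> carrier G \<Longrightarrow> y \<in> carrier G \<Longrightarrow> w \<in> carrier G \<Longrightarrow>
      ?t w (?t y x) = inv\<^bsub>G\<^esub> (g x (y \<otimes>\<^bsub>G\<^esub> w)) \<otimes>\<^bsub>G\<^esub> x \<otimes>\<^bsub>G\<^esub> y \<otimes>\<^bsub>G\<^esub> w"
    and g_closed: "\<And>x y. x \<in> carrier G \<Longrightarrow> y \<in> carrier G \<Longrightarrow> g x y \<in> carrier G"
  proof -
    from assms(2) obtain f g where
      bij: "\<forall>x\<in>carrier G. bij_betw (g x) (carrier G) (carrier G)" and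
      *: "\<forall>x\<in>carrier G. \<forall>y\<in>carrier G. \<forall>w\<in>carrier G.
           x \<otimes>\<^bsub>G\<^esub> y = ?s x y \<otimes>\<^bsub>G\<^esub> ?t y x \<and>
           (id_times_mult G \<circ> act12 r \<circ> act23 r) (x, y, w) =
             (f (x \<otimes>\<^bsub>G\<^esub> y) w, inv\<^bsub>G\<^esub> (f (x \<otimes>\<^bsub>G\<^esub> y) w) \<otimes>\<^bsub>G\<^esub> x \<otimes>\<^bsub>G\<^esub> y \<otimes>\<^bsub>G\<^esub> w) \<and>
           (mult_times_id G \<circ> act23 r \<circ> act12 r) (x, y, w) =
             (g x (y \<otimes>\<^bsub>G\<^esub> w), inv\<^bsub>G\<^esub> (g x (y \<otimes>\<^bsub>G\<^esub> w)) \<otimes>\<^bsub>G\<^esub> x \<otimes>\<^bsub>G\<^esub> y \<otimes>\<^bsub>G\<^esub> w)"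
      unfolding p_braiding_operator_def by blast
    show thesis
    proof (rule that[of f g])
      fix x y assume "x \<in> carrier G" "y \<in> carrier G"
      then show "?s x y \<otimes>\<^bsub>G\<^esub> ?t y x = x \<otimes>\<^bsub>G\<^esub> y" and "g x y \<in> carrier G"
        using * bij by (metis, metis bij_betwE)
    next
      fix x y w assume "x \<in> carrier G" "y \<in> carrier G" "w \<in> carrier G"
      then show "?s x (?s y w) = f (x \<otimes>\<^bsub>G\<^esub> y) w"
        and "?t w (?t y x) = inv\<^bsub>G\<^esub> (g x (y \<otimes>\<^bsub>G\<^esub> w)) \<otimes>\<^bsub>G\<^esub> x \<otimes>\<^bsub>G\<^esub> y \<otimes>\<^bsub>G\<^esub> w"
        using *[rule_format, of x y w]
        by (simp_all add: id_times_mult_def mult_times_id_def act12_def act23_def r_eq)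
    qed
  qed
  show "braid_solution (carrier G) r"
    unfolding braid_solution_def
  proof (clarify)
    fix x y w assume x: "x \<in> carrier G" and y: "y \<in> carrier G" and w: "w \<in> carrier G"
    note xyw = x y w
    \<comment> \<open>The entries of the left side of the braid equation at
      \<open>(x, y, w)\<close>; the primed ones are those of the right side.\<close>
    let ?a = "?s (?s x y) (?s (?t y x) w)" and ?b = "?t (?s (?t y x) w) (?s x y)"
      and ?c = "?t w (?t y x)"
    let ?a' = "?s x (?s y w)" and ?b' = "?s (?t (?s y w) x) (?t w y)"
      and ?c' = "?t (?t w y) (?t (?s y w) x)"
    \<comment> \<open>By \<open>f\<close>, both sides are values at \<open>w\<close>, with indices
      \<open>?s x y \<otimes> ?t y x\<close> and \<open>x \<otimes> y\<close>, which agree by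
      (1).\<close>
    have a: "?a = ?a'"
      using xyw by (simp add: f closed mult)
    \<comment> \<open>Dually, \<open>g\<close> is used with
      \<open>?s y w \<otimes> ?t w y = y \<otimes> w\<close>; reassociation exposes this product
      outside the argument of \<open>g\<close> as well.\<close>
    have c: "?c = ?c'"
      using xyw by (simp add: g closed mult g_closed m_assoc)
    \<comment> \<open>The chain undoes the three applications of \<open>r\<close> on the left side,
      passing through \<open>x \<otimes> y \<otimes> w\<close>, and then performs the three on the
      right side.\<close>
    have "?a \<otimes>\<^bsub>G\<^esub> ?b \<otimes>\<^bsub>G\<^esub> ?c = ?s x y \<otimes>\<^bsub>G\<^esub> (?s (?t y x) w \<otimes>\<^bsub>G\<^esub> ?c)"
      using xyw by (simp only: mult closed m_assoc)
    also have "\<dots> = ?s x y \<otimes>\<^bsub>G\<^esub> ?t y x \<otimes>\<^bsub>G\<^esub> w"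
      using xyw by (simp only: mult closed m_assoc[symmetric])
    also have "\<dots> = x \<otimes>\<^bsub>G\<^esub> (?s y w \<otimes>\<^bsub>G\<^esub> ?t w y)"
      using xyw by (simp only: mult closed m_assoc)
    also have "\<dots> = x \<otimes>\<^bsub>G\<^esub> ?s y w \<otimes>\<^bsub>G\<^esub> ?t w y"
      using xyw by (simp only: closed m_assoc)
    also have "\<dots> = ?a' \<otimes>\<^bsub>G\<^esub> ?t (?s y w) x \<otimes>\<^bsub>G\<^esub> ?t w y"
      using xyw by (simp only: mult closed)
    \<comment> \<open>Bracketing to the right makes \<open>?b' \<otimes> ?c'\<close> a subterm that
      (1) can contract.\<close>
    also have "\<dots> = ?a' \<otimes>\<^bsub>G\<^esub> ?b' \<otimes>\<^bsub>G\<^esub> ?c'"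
      using xyw by (subst (1 2) m_assoc) (simp_all only: mult closed m_closed)
    finally have "?a' \<otimes>\<^bsub>G\<^esub> ?b \<otimes>\<^bsub>G\<^esub> ?c' = ?a' \<otimes>\<^bsub>G\<^esub> ?b' \<otimes>\<^bsub>G\<^esub> ?c'"
      by (simp only: a c)
    then have "?b = ?b'"
      using xyw by (simp add: closed)
    with a c show "(act12 r \<circ> act23 r \<circ> act12 r) (x, y, w) =
        (act23 r \<circ> act12 r \<circ> act23 r) (x, y, w)"
      by (simp add: act12_def act23_def r_eq)
  qed
qed

end
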